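(* Suppose that there exists $\varepsilon_0>0$ such that $S_{\Gamma}\geq \varepsilon_0$ for every finitely generated metabelian group $\Gamma$ that is not virtually nilpotent. Then the Lehmer conjecture holds, i.e. there exists a universal $\varepsilon_1>0$ such that for every monic polynomial $\pi\in\mathbb{Z}[X]$, if $m(\pi)>1$ then $m(\pi)>1+\varepsilon_1$.
   Context: For a finitely generated group $\Gamma$, let $\mathcal{C}$ be the set of all finite generating subsets $\Sigma$ of $\Gamma$ that are symmetric ($s\in\Sigma\Rightarrow s^{-1}\in\Sigma$) and contain the identity. For $\Sigma\in\mathcal{C}$, $\Sigma^n$ denotes the set of all products of at most $n$ elements of $\Sigma$, and $S_{\Gamma}(\Sigma)=\lim_{n\to\infty}\frac1n\log(\#\Sigma^n)$. The algebraic entropy of $\Gamma$ is $S_{\Gamma}=\inf_{\Sigma\in\mathcal{C}}S_{\Gamma}(\Sigma)$. A group is metabelian if it is an extension of an abelian group by an abelian group, and virtually nilpotent if it has a nilpotent subgroup of finite index. For a monic polynomial $\pi\in\mathbb{Z}[X]$ with factorization $\pi=\prod_{1\leq i\leq d}(X-\lambda_i)$ over $\mathbb{C}$, the Mahler measure is $m(\pi)=\prod_{1\leq i\leq d}\max\{1,|\lambda_i|\}$. *)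

theory Defs
  imports
    Complex_Main
    "HOL-Library.Countable_Set"
    "HOL-Algebra.Generated_Groups"
    "Berlekamp_Zassenhaus.Mahler_Measure"
begin

section \<open>Algebraic entropy of a finitely generated group\<close>

definition finitely_generated_group :: "('a, 'b) monoid_scheme \<Rightarrow> bool" where
  "finitely_generated_group G \<longleftrightarrow>
     group G \<and> (\<exists>S. finite S \<and> S \<subseteq> carrier G \<and> generate G S = carrier G)"

definition sym_generating_sets :: "('a, 'b) monoid_scheme \<Rightarrow> 'a set set" where
  "sym_generating_sets G =
     {S. finite S \<and> S \<subseteq> carrier G \<and> generate G S = carrier G \<and>
         (\<forall>s\<in>S. inv\<^bsub>G\<^esub> s \<in> S) \<and> \<one>\<^bsub>G\<^esub> \<in> S}"

definition products_upto :: "('a, 'b) monoid_scheme \<Rightarrow> 'a set \<Rightarrow> nat \<Rightarrow> 'a set" where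
  "products_upto G S n =
     {foldr (\<lambda>x y. x \<otimes>\<^bsub>G\<^esub> y) xs \<one>\<^bsub>G\<^esub> | xs. set xs \<subseteq> S \<and> length xs \<le> n}"

text \<open>The limit exists for every finite subset containing the identity, since the
  logarithms of the cardinalities are subadditive in \<open>n\<close>.\<close>

definition entropy_wrt :: "('a, 'b) monoid_scheme \<Rightarrow> 'a set \<Rightarrow> real" where
  "entropy_wrt G S = lim (\<lambda>n. 1 / real n * ln (real (card (products_upto G S n))))"

definition algebraic_entropy :: "('a, 'b) monoid_scheme \<Rightarrow> real" where
  "algebraic_entropy G = (INF S\<in>sym_generating_sets G. entropy_wrt G S)"

section \<open>Metabelian and virtually nilpotent groups\<close>

definition metabelian_group :: "('a, 'b) monoid_scheme \<Rightarrow> bool" where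
  "metabelian_group G \<longleftrightarrow>
     (\<exists>N. N \<lhd> G \<and> comm_group (G\<lparr>carrier := N\<rparr>) \<and> comm_group (G Mod N))"

fun lower_central_series :: "('a, 'b) monoid_scheme \<Rightarrow> nat \<Rightarrow> 'a set" where
  "lower_central_series G 0 = carrier G"
| "lower_central_series G (Suc n) =
     generate G {x \<otimes>\<^bsub>G\<^esub> y \<otimes>\<^bsub>G\<^esub> inv\<^bsub>G\<^esub> x \<otimes>\<^bsub>G\<^esub> inv\<^bsub>G\<^esub> y | x y.
                   x \<in> lower_central_series G n \<and> y \<in> carrier G}"

definition nilpotent_group :: "('a, 'b) monoid_scheme \<Rightarrow> bool" where
  "nilpotent_group G \<longleftrightarrow> group G \<and> (\<exists>n. lower_central_series G n = {\<one>\<^bsub>G\<^esub>})"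

definition virtually_nilpotent_group :: "('a, 'b) monoid_scheme \<Rightarrow> bool" where
  "virtually_nilpotent_group G \<longleftrightarrow>
     (\<exists>H. subgroup H G \<and> finite (rcosets\<^bsub>G\<^esub> H) \<and> nilpotent_group (G\<lparr>carrier := H\<rparr>))"

section \<open>Groups with carrier in the natural numbers\<close>

text \<open>Finitely generated groups are countable, so quantifying over groups of type
  \<^typ>\<open>nat monoid\<close> (the carrier being an arbitrary set of natural numbers) covers all
  finitely generated groups up to isomorphism.\<close>

lemma (in group) countable_generate:
  assumes "countable S"
  shows "countable (generate G S)"
proof -
  define C where "C = rec_nat (S \<union> (\<lambda>x. inv x) ` S \<union> {\<one>}) (\<lambda>_ A. A \<union> (\<lambda>(x, y). x \<otimes> y) ` (A \<times> A))"
  have C0: "C 0 = S \<union> (\<lambda>x. inv x) ` S \<union> {\<one>}"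
    and CS: "\<And>n. C (Suc n) = C n \<union> (\<lambda>(x, y). x \<otimes> y) ` (C n \<times> C n)"
    by (simp_all add: C_def)
  have mono: "C m \<subseteq> C n" if "m \<le> n" for m n
    using that by (rule lift_Suc_mono_le[rotated]) (auto simp: CS)
  have "countable (C n)" for n
    by (induction n) (use assms in \<open>auto simp: C0 CS intro!: countable_image countable_SIGMA\<close>)
  moreover have "x \<in> (\<Union>n. C n)" if "x \<in> generate G S" for x
    using that
  proof induction
    case (eng h1 h2)
    then obtain m n where "h1 \<in> C m" "h2 \<in> C n" by auto
    then have "h1 \<in> C (max m n)" "h2 \<in> C (max m n)"
      using mono[of m "max m n"] mono[of n "max m n"] by auto
    then have "h1 \<otimes> h2 \<in> C (Suc (max m n))" by (auto simp: CS)
    then show ?case by blast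
  qed (use C0 in auto)
  ultimately show ?thesis
    by (meson countable_UN countable_subset subsetI countableI_type)
qed

lemma finitely_generated_group_iso_nat:
  assumes "finitely_generated_group G"
  shows "\<exists>K :: nat monoid. group K \<and> G \<cong> K"
proof -
  interpret group G using assms by (simp add: finitely_generated_group_def)
  have "countable (carrier G)"
    using assms countable_generate countable_finite
    unfolding finitely_generated_group_def by metis
  then obtain f :: "_ \<Rightarrow> nat" where f: "inj_on f (carrier G)"
    by (auto simp: countable_def)
  define g where "g = the_inv_into (carrier G) f"
  define K where "K = \<lparr>carrier = f ` carrier G, monoid.mult = (\<lambda>x y. f (g x \<otimes>\<^bsub>G\<^esub> g y)), one = f \<one>\<^bsub>G\<^esub>\<rparr>"
  have gf: "g (f x) = x" if "x \<in> carrier G" for x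
    using that f by (simp add: g_def the_inv_into_f_f)
  have "f \<in> iso G K"
    using f by (auto simp: iso_def hom_def bij_betw_def K_def gf)
  moreover have "group K"
  proof (rule groupI)
    fix x assume "x \<in> carrier K"
    then obtain a where "a \<in> carrier G" "x = f a" by (auto simp: K_def)
    then show "\<exists>y\<in>carrier K. y \<otimes>\<^bsub>K\<^esub> x = \<one>\<^bsub>K\<^esub>"
      by (intro bexI[of _ "f (inv\<^bsub>G\<^esub> a)"]) (auto simp: K_def gf)
  qed (auto simp: K_def gf m_assoc)
  ultimately show ?thesis by (auto simp: is_iso_def)
qed

section \<open>Mahler measure\<close>

text \<open>The library's Mahler measure has the additional factor \<open>\<bar>lead_coeff\<bar>\<close>, which is 1 for
  monic polynomials, and uses a chosen list of roots.\<close>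

lemma mahler_measure_monic_eq:
  assumes "map_poly of_int p = (\<Prod>a\<leftarrow>as. [:- a, 1 :: complex:])"
  shows "mahler_measure p = (\<Prod>a\<leftarrow>as. max 1 (cmod a))"
proof -
  let ?q = "map_poly of_int p :: complex poly"
  have lc: "lead_coeff ?q = 1"
    unfolding assms by (rule monic_prod_list) auto
  have "(\<Prod>a\<leftarrow>complex_roots_complex ?q. [:- a, 1:]) = ?q"
    using complex_roots(1)[of ?q] lc by simp
  then have "mset (complex_roots_complex ?q) = mset as"
    using assms by (intro reconstruct_poly_monic_defines_mset) simp
  then have "mset (map (\<lambda>a. max 1 (cmod a)) (complex_roots_complex ?q)) =
             mset (map (\<lambda>a. max 1 (cmod a)) as)"
    by simp
  then have "(\<Prod>a\<leftarrow>complex_roots_complex ?q. max 1 (cmod a)) = (\<Prod>a\<leftarrow>as. max 1 (cmod a))"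
    by (metis prod_mset_prod_list)
  then show ?thesis
    using lc by (simp add: mahler_measure_def mahler_measure_poly_def)
qed

end

theory Submission
  imports Defs "Berlekamp_Zassenhaus.Factor_Bound" "HOL-Real_Asymp.Real_Asymp"
begin

text \<open>
  Let \<open>\<theta>\<close> be a root of \<open>\<pi>\<close> with \<open>\<bar>\<theta>\<bar> > 1\<close>, which exists if \<open>m(\<pi>) > 1\<close>, and let \<open>p\<close> be its minimal
  polynomial, an irreducible factor of \<open>\<pi>\<close> with \<open>m(p) \<le> m(\<pi>)\<close> (\<open>irreducible_monic_factor\<close>).  Consider
  the group of affine maps of the complex plane generated by \<open>z \<mapsto> \<theta> * z\<close> and \<open>z \<mapsto> z + 1\<close>.  It is
  metabelian (\<open>metabelian\<close>), the translations forming the abelian normal subgroup.  It is not virtually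
  nilpotent (\<open>not_virtually_nilpotent\<close>), because commutators with a power of the dilation multiply
  translations by a nonzero number.

  The entropy of this group is at most \<open>4 * ln (m(p))\<close> (\<open>entropy_le_mahler\<close>).  Up to a power of \<open>\<theta>\<close>,
  the translation part of a word of length at most \<open>n\<close> in the generators is \<open>P(\<theta>)\<close> for an
  integer polynomial \<open>P\<close> which is a sum of at most \<open>n\<close> signed monomials of degree at most \<open>2 * n\<close>
  (\<open>word_parts\<close>).  Distinct such values cannot be close to each other: the norm of their difference,
  the product over all conjugates, is a nonzero integer (\<open>prod_values_at_roots_integral\<close>,
  \<open>liouville_separation\<close>).  Comparing this separation with the size of the disc that contains the values
  (\<open>card_separated_points_le\<close>) leaves \<open>m(p) ^ (4 * n)\<close> possibilities up to a factor polynomial in \<open>n\<close>.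

  A uniform lower bound \<open>\<epsilon>\<^sub>0\<close> for the entropy therefore yields \<open>m(\<pi>) \<ge> m(p) \<ge> exp (\<epsilon>\<^sub>0 / 4)\<close>.
\<close>

section \<open>Values of integer polynomials at algebraic integers\<close>

abbreviation cpoly :: "int poly \<Rightarrow> complex poly" where
  "cpoly \<equiv> map_poly of_int"

lemma exists_monic_remainder:
  fixes f p :: "'a :: idom poly"
  assumes "lead_coeff p = 1"
  shows "\<exists>q r. f = p * q + r \<and> (r = 0 \<or> degree r < degree p)"
proof -
  obtain q r where qr: "pseudo_divmod f p = (q, r)" by fastforce
  have "p \<noteq> 0" using assms by auto
  from pseudo_divmod[OF this qr] assms show ?thesis by auto
qed

text \<open>
  The product is the norm of \<open>R\<close> in \<open>\<int>[X]/(p)\<close>, that is, the determinant of the integer matrix \<open>M\<close> of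
  multiplication by \<open>R\<close> on the basis \<open>1, X, \<dots>\<close>.  Over the complex numbers the Vandermonde matrix \<open>V\<close>
  of the roots satisfies \<open>V * M = D * V\<close> with \<open>D\<close> diagonal with entries \<open>R(x)\<close>; since the roots are
  distinct, \<open>V\<close> is invertible and \<open>det M = det D\<close>.
\<close>
lemma prod_values_at_roots_integral:
  fixes p R :: "int poly" and xs :: "complex list"
  assumes monic: "lead_coeff p = 1" and dist: "distinct xs" and len: "length xs = degree p"
    and roots: "\<And>x. x \<in> set xs \<Longrightarrow> poly (cpoly p) x = 0"
  shows "\<exists>k :: int. (\<Prod>x\<leftarrow>xs. poly (cpoly R) x) = of_int k"
proof -
  define d where "d = degree p"
  have "\<forall>j. \<exists>q r. R * monom 1 j = p * q + r \<and> (r = 0 \<or> degree r < degree p)"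
    using exists_monic_remainder[OF monic] by blast
  then obtain q r where qr: "\<And>j. R * monom 1 j = p * q j + r j"
    and deg: "\<And>j. r j = 0 \<or> degree (r j) < degree p"
    by metis
  define M where "M = mat d d (\<lambda>(k, j). coeff (r j) k)"
  define V where "V = mat d d (\<lambda>(i, k). (xs ! i) ^ k)"
  define D where "D = mat d d (\<lambda>(i, j). if i = j then poly (cpoly R) (xs ! i) else 0)"
  have [simp]: "M \<in> carrier_mat d d" "V \<in> carrier_mat d d" "D \<in> carrier_mat d d"
    by (auto simp: M_def V_def D_def)
  have eval: "poly (cpoly (r j)) x = poly (cpoly R) x * x ^ j" if "x \<in> set xs" for x j
  proof -
    have "poly (cpoly (R * monom 1 j)) x = poly (cpoly (p * q j + r j)) x"
      using qr by simp
    then show ?thesis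
      using roots[OF that] by (simp add: hom_distribs poly_monom of_int_poly_hom.hom_mult)
  qed
  have eval_sum: "poly (cpoly f) x = (\<Sum>k<d. of_int (coeff f k) * x ^ k)"
    if "f = 0 \<or> degree f < d" for f and x :: complex
  proof (cases "d = 0")
    case False
    then have "degree f \<le> d - 1" using that by auto
    then have "poly (cpoly f) x = (\<Sum>k\<le>d - 1. of_int (coeff f k) * x ^ k)"
      by (subst poly_altdef, intro sum.mono_neutral_cong_left) (auto simp: coeff_eq_0)
    also have "{..d - 1} = {..<d}" using False by auto
    finally show ?thesis .
  qed (use that in auto)
  have VM: "V * map_mat of_int M = D * V"
  proof (rule eq_matI)
    fix i j assume ij: "i < dim_row (D * V)" "j < dim_col (D * V)"
    then have ij: "i < d" "j < d" by (auto simp: D_def V_def)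
    have "(V * map_mat of_int M) $$ (i, j) = (\<Sum>k<d. xs ! i ^ k * of_int (coeff (r j) k))"
      using ij by (simp add: V_def M_def scalar_prod_def lessThan_atLeast0)
    also have "\<dots> = poly (cpoly (r j)) (xs ! i)"
      using deg[of j] by (subst eval_sum) (auto simp: d_def mult.commute)
    also have "\<dots> = poly (cpoly R) (xs ! i) * (xs ! i) ^ j"
      using ij len by (intro eval) (auto simp: d_def)
    also have "\<dots> = (D * V) $$ (i, j)"
      using ij by (simp add: V_def D_def scalar_prod_def if_distrib if_distribR cong: if_cong)
    finally show "(V * map_mat of_int M) $$ (i, j) = (D * V) $$ (i, j)" .
  qed (auto simp: V_def M_def D_def)
  \<comment> \<open>A kernel vector would be the coefficients of a nonzero polynomial of degree below \<open>d\<close> with \<open>d\<close> roots.\<close>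
  have "det V \<noteq> 0"
  proof
    assume "det V = 0"
    then obtain v where v: "v \<in> carrier_vec d" "v \<noteq> 0\<^sub>v d" "V *\<^sub>v v = 0\<^sub>v d"
      using det_0_iff_vec_prod_zero[of V d] by auto
    define f where "f = (\<Sum>k<d. monom (v $ k) k)"
    have cf: "coeff f k = (if k < d then v $ k else 0)" for k
      by (auto simp: f_def coeff_sum coeff_monom)
    from v(1,2) obtain k where "k < d" "v $ k \<noteq> 0"
      by (metis carrier_vecD eq_vecI index_zero_vec(1,2))
    then have "f \<noteq> 0" using cf by (metis coeff_0)
    have degf: "degree f < d" if "d > 0"
      using that by (intro degree_lessI) (auto simp: cf)
    have "poly f x = 0" if "x \<in> set xs" for x
    proof -
      from that obtain i where i: "i < d" "x = xs ! i" using len by (auto simp: in_set_conv_nth d_def)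
      have "(V *\<^sub>v v) $ i = (\<Sum>k<d. x ^ k * v $ k)"
        using i v(1) by (simp add: V_def scalar_prod_def lessThan_atLeast0)
      also have "\<dots> = poly f x"
        by (simp add: f_def poly_sum poly_monom mult.commute)
      finally show ?thesis using v(3) i by simp
    qed
    then have "set xs \<subseteq> {x. poly f x = 0}" by auto
    then have "card (set xs) \<le> degree f"
      using card_mono[OF poly_roots_finite[OF \<open>f \<noteq> 0\<close>]] poly_roots_degree[OF \<open>f \<noteq> 0\<close>] by (meson le_trans)
    then have "d \<le> degree f" using dist len by (simp add: distinct_card d_def)
    with degf \<open>k < d\<close> show False by auto
  qed
  have "det V * det (map_mat complex_of_int M) = det D * det V"
    using arg_cong[OF VM, of det] by (simp add: det_mult[of _ d])
  then have "det D = of_int (det M)"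
    using \<open>det V \<noteq> 0\<close> by (simp add: of_int_hom.hom_det)
  moreover have "det D = (\<Prod>x\<leftarrow>xs. poly (cpoly R) x)"
  proof -
    have "diag_mat D = map (\<lambda>i. poly (cpoly R) (xs ! i)) [0..<d]"
      by (auto simp: diag_mat_def D_def)
    also have "\<dots> = map (\<lambda>x. poly (cpoly R) x) xs"
      by (rule nth_equalityI) (auto simp: len d_def)
    finally have "diag_mat D = map (poly (cpoly R)) xs" .
    moreover have "det D = prod_list (diag_mat D)"
      by (rule det_upper_triangular[of _ d]) (auto simp: upper_triangular_def D_def)
    ultimately show ?thesis by simp
  qed
  ultimately show ?thesis by auto
qed

text \<open>
  Over the rationals the gcd of \<open>p\<close> and \<open>R\<close> is a combination of both, hence also vanishes at the common
  root and is not constant; by Gauss's lemma \<open>p\<close> stays irreducible there, so the gcd is \<open>p\<close> itself.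
\<close>
lemma irreducible_dvd_if_common_root:
  fixes p R :: "int poly"
  assumes irr: "irreducible\<^sub>d p" and "poly (cpoly p) x = 0" "poly (cpoly R) x = 0"
  shows "map_poly rat_of_int p dvd map_poly rat_of_int R"
proof -
  interpret of_rat_poly_hom: map_poly_comm_ring_hom "of_rat :: rat \<Rightarrow> complex" ..
  let ?Q = "map_poly rat_of_int"
  let ?C = "map_poly (of_rat :: rat \<Rightarrow> complex)"
  have CQ: "?C (?Q f) = cpoly f" for f
    by (simp add: map_poly_map_poly o_def)
  have irr': "irreducible\<^sub>d (?Q p)" by (rule irreducible\<^sub>d_int_rat[OF irr])
  then have "degree (?Q p) > 0" "?Q p \<noteq> 0" by auto
  define g where "g = gcd (?Q p) (?Q R)"
  have "g \<noteq> 0" using \<open>?Q p \<noteq> 0\<close> by (simp add: g_def)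
  obtain a b where ab: "g = a * ?Q p + b * ?Q R"
    unfolding g_def using bezout_coefficients_fst_snd by metis
  have "poly (?C g) x = 0"
    unfolding ab using assms(2,3) CQ
    by (simp add: of_rat_poly_hom.hom_add of_rat_poly_hom.hom_mult)
  then have "degree g \<noteq> 0"
  proof (rule contrapos_pn)
    assume "degree g = 0"
    then obtain c where "g = [:c:]" by (rule degree_eq_zeroE)
    then show "poly (?C g) x \<noteq> 0" using \<open>g \<noteq> 0\<close> by simp
  qed
  obtain h where h: "?Q p = g * h" unfolding g_def by (meson dvdE gcd_dvd1)
  have "h \<noteq> 0" using h \<open>?Q p \<noteq> 0\<close> by auto
  have "degree (?Q p) = degree g + degree h"
    using h \<open>g \<noteq> 0\<close> \<open>h \<noteq> 0\<close> degree_mult_eq by metis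
  then have "degree h = 0"
    using irreducible\<^sub>dD(2)[OF irr', of g h] h \<open>degree g \<noteq> 0\<close> by force
  then have "h dvd 1" using \<open>h \<noteq> 0\<close> by (simp add: is_unit_iff_degree)
  then have "?Q p dvd g" using h by (metis dvd_refl mult_unit_dvd_iff)
  then show ?thesis by (simp add: g_def)
qed

lemma irreducible_all_roots_if_common_root:
  fixes p R :: "int poly"
  assumes "irreducible\<^sub>d p" "poly (cpoly p) x = 0" "poly (cpoly R) x = 0" "poly (cpoly p) y = 0"
  shows "poly (cpoly R) y = 0"
proof -
  interpret of_rat_poly_hom: map_poly_comm_ring_hom "of_rat :: rat \<Rightarrow> complex" ..
  have CQ: "map_poly (of_rat :: rat \<Rightarrow> complex) (map_poly rat_of_int f) = cpoly f" for f
    by (simp add: map_poly_map_poly o_def)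
  obtain k where "map_poly rat_of_int R = map_poly rat_of_int p * k"
    using irreducible_dvd_if_common_root[OF assms(1-3)] by (auto elim: dvdE)
  then have "cpoly R = cpoly p * map_poly of_rat k"
    by (metis CQ of_rat_poly_hom.hom_mult)
  then show ?thesis using assms(4) by simp
qed

lemma cpoly_monic_roots:
  assumes "lead_coeff p = 1"
  shows "cpoly p = (\<Prod>a\<leftarrow>complex_roots_int p. [:- a, 1:])"
    and "poly (cpoly p) x = 0 \<longleftrightarrow> x \<in> set (complex_roots_int p)"
proof -
  show *: "cpoly p = (\<Prod>a\<leftarrow>complex_roots_int p. [:- a, 1:])"
    using complex_roots_int(1)[of p] assms by simp
  then show "poly (cpoly p) x = 0 \<longleftrightarrow> x \<in> set (complex_roots_int p)"
    by (auto simp: poly_prod_list prod_list_zero_iff)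
qed

text \<open>A multiple root would be a common root with the derivative, which has smaller degree.\<close>
lemma irreducible_distinct_roots:
  fixes p :: "int poly"
  assumes irr: "irreducible\<^sub>d p" and "lead_coeff p = 1"
  shows "distinct (complex_roots_int p)"
proof -
  have "degree p > 0" using irr by auto
  have "\<not> (poly (cpoly p) x = 0 \<and> poly (pderiv (cpoly p)) x = 0)" for x
  proof
    assume *: "poly (cpoly p) x = 0 \<and> poly (pderiv (cpoly p)) x = 0"
    have "pderiv (cpoly p) = cpoly (pderiv p)" by (simp add: of_int_hom.map_poly_pderiv)
    with * have "map_poly rat_of_int p dvd map_poly rat_of_int (pderiv p)"
      using irreducible_dvd_if_common_root[OF irr] by metis
    moreover have "pderiv p \<noteq> 0" using \<open>degree p > 0\<close> by (simp add: pderiv_eq_0_iff)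
    ultimately have "degree (map_poly rat_of_int p) \<le> degree (map_poly rat_of_int (pderiv p))"
      by (intro dvd_imp_degree_le) auto
    with \<open>degree p > 0\<close> show False by (simp add: degree_pderiv)
  qed
  then have "rsquarefree (cpoly p)" by (simp add: rsquarefree_roots)
  moreover have "cpoly p \<noteq> 0" using assms(2) by auto
  ultimately have "card {x. poly (cpoly p) x = 0} = degree (cpoly p)"
    by (simp add: rsquarefree_card_degree)
  moreover have "{x. poly (cpoly p) x = 0} = set (complex_roots_int p)"
    using cpoly_monic_roots(2)[OF assms(2)] by blast
  ultimately show ?thesis
    using complex_roots_int(2)[of p] by (simp add: card_distinct)
qed

lemma mahler_measure_monic_ge_1:
  assumes "lead_coeff p = 1"
  shows "mahler_measure p \<ge> 1"
proof -
  have "(\<Prod>a\<leftarrow>as. max 1 (cmod a)) \<ge> 1" for as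
  proof (induction as)
    case (Cons a as)
    have "1 * 1 \<le> max 1 (cmod a) * (\<Prod>a\<leftarrow>as. max 1 (cmod a))"
      by (rule mult_mono) (use Cons in auto)
    then show ?case by simp
  qed auto
  then show ?thesis
    using mahler_measure_monic_eq[OF cpoly_monic_roots(1)[OF assms]] by simp
qed

text \<open>
  Passing to an irreducible factor is harmless because the cofactor is monic and so has Mahler measure
  at least 1.  Irreducibility is needed for the norm of a nonzero element to be nonzero.
\<close>
lemma irreducible_monic_factor:
  fixes \<pi> :: "int poly"
  assumes monic: "lead_coeff \<pi> = 1" and gt: "mahler_measure \<pi> > 1"
  shows "\<exists>p \<theta>. irreducible\<^sub>d p \<and> lead_coeff p = 1 \<and> poly (cpoly p) \<theta> = 0 \<and> cmod \<theta> > 1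
           \<and> mahler_measure p \<le> mahler_measure \<pi>"
proof -
  have "\<exists>\<theta>\<in>set (complex_roots_int \<pi>). cmod \<theta> > 1"
  proof (rule ccontr)
    assume "\<not> ?thesis"
    then have "map (\<lambda>a. max 1 (cmod a)) (complex_roots_int \<pi>) = map (\<lambda>_. 1) (complex_roots_int \<pi>)"
      by (intro map_cong) auto
    then have "mahler_measure \<pi> = 1"
      using mahler_measure_monic_eq[OF cpoly_monic_roots(1)[OF monic]] by (simp add: map_replicate_const)
    with gt show False by simp
  qed
  then obtain \<theta> where \<theta>: "poly (cpoly \<pi>) \<theta> = 0" "cmod \<theta> > 1"
    using cpoly_monic_roots(2)[OF monic] by blast
  have "degree \<pi> > 0"
  proof (rule ccontr)
    assume "\<not> ?thesis"
    then obtain c where "\<pi> = [:c:]" by (auto elim: degree_eq_zeroE)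
    with monic \<theta> show False by simp
  qed
  then obtain fs where fs: "\<forall>f\<in>set fs. irreducible\<^sub>d f" "\<pi> = prod_list fs"
    using irreducible\<^sub>d_factorization_exists(1) by metis
  from \<theta>(1) have "\<exists>f\<in>set fs. poly (cpoly f) \<theta> = 0"
    unfolding fs(2) by (induction fs) (auto simp: of_int_poly_hom.hom_mult)
  then obtain f where f: "f \<in> set fs" "poly (cpoly f) \<theta> = 0" by auto
  then have "f dvd \<pi>" using fs(2) by (simp add: prod_list_dvd)
  then obtain g where g: "\<pi> = f * g" by (auto elim: dvdE)
  then have "lead_coeff f * lead_coeff g = 1" using monic by (simp add: lead_coeff_mult)
  then have cases: "lead_coeff f = 1 \<and> lead_coeff g = 1 \<or> lead_coeff f = -1 \<and> lead_coeff g = -1"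
    by (auto simp: zmult_eq_1_iff)
  define p q where "p = smult (lead_coeff f) f" and "q = smult (lead_coeff f) g"
  have pq: "lead_coeff p = 1" "lead_coeff q = 1" "\<pi> = p * q"
    using cases g by (auto simp: p_def q_def)
  have "irreducible\<^sub>d p"
    unfolding p_def using fs(1) f(1) cases by (intro irreducible\<^sub>d_smultI[of "lead_coeff f" "smult (lead_coeff f) f"]) auto
  moreover have "poly (cpoly p) \<theta> = 0"
    using f(2) cases by (auto simp: p_def of_int_poly_hom.hom_uminus)
  moreover have "mahler_measure p \<le> mahler_measure \<pi>"
  proof -
    have "mahler_measure \<pi> = mahler_measure p * mahler_measure q"
      by (simp add: pq(3) mahler_measure_def of_int_poly_hom.hom_mult measure_eq_prod)
    moreover have "mahler_measure p * 1 \<le> mahler_measure p * mahler_measure q"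
      using mahler_measure_monic_ge_1[OF pq(1)] mahler_measure_monic_ge_1[OF pq(2)]
      by (intro mult_left_mono) auto
    ultimately show ?thesis by simp
  qed
  ultimately show ?thesis using pq(1) \<theta>(2) by blast
qed

text \<open>
  Liouville's argument: the norm of \<open>R(\<theta>)\<close> is a nonzero integer, so \<open>\<bar>R(\<theta>)\<bar>\<close> is at least the
  inverse of the product of the bounds at the other conjugates.  Multiplying both sides by the bound
  at \<open>\<theta>\<close> completes that product to \<open>C ^ degree p * m(p) ^ n\<close>.
\<close>
lemma liouville_separation:
  fixes p R :: "int poly"
  assumes irr: "irreducible\<^sub>d p" and monic: "lead_coeff p = 1"
    and root: "poly (cpoly p) \<theta> = 0" and nz: "poly (cpoly R) \<theta> \<noteq> 0"
    and C: "C \<ge> 1" and bound: "\<And>\<mu>. poly (cpoly p) \<mu> = 0 \<Longrightarrow> cmod (poly (cpoly R) \<mu>) \<le> C * max 1 (cmod \<mu>) ^ n"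
  shows "max 1 (cmod \<theta>) ^ n \<le> cmod (poly (cpoly R) \<theta>) * (C ^ degree p * mahler_measure p ^ n)"
proof -
  define xs where "xs = complex_roots_int p"
  define X where "X = set xs"
  have dist: "distinct xs" unfolding xs_def by (rule irreducible_distinct_roots[OF irr monic])
  have X: "x \<in> X \<longleftrightarrow> poly (cpoly p) x = 0" for x
    using cpoly_monic_roots(2)[OF monic] by (simp add: X_def xs_def)
  have list: "(\<Prod>x\<leftarrow>xs. f x) = (\<Prod>x\<in>X. f x)" for f :: "complex \<Rightarrow> 'b :: comm_monoid_mult"
    unfolding X_def using dist by (simp add: prod.distinct_set_conv_list)
  have len: "length xs = degree p" by (simp add: xs_def complex_roots_int)
  then have cardX: "card X = degree p" using dist by (simp add: X_def distinct_card)
  have [simp]: "finite X" by (simp add: X_def)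
  obtain k where k: "(\<Prod>x\<leftarrow>xs. poly (cpoly R) x) = of_int k"
    using prod_values_at_roots_integral[OF monic dist len] X by (auto simp: X_def)
  have "poly (cpoly R) x \<noteq> 0" if "x \<in> X" for x
    using irreducible_all_roots_if_common_root[OF irr _ _ root] X that nz by blast
  then have "k \<noteq> 0" using k list by (metis \<open>finite X\<close> of_int_0 prod_zero_iff)
  let ?B = "\<lambda>x. C * max 1 (cmod x) ^ n"
  have B1: "?B x > 0" for x :: complex using C by (simp add: less_max_iff_disj)
  have "1 \<le> cmod (of_int k :: complex)" using \<open>k \<noteq> 0\<close> by simp
  also have "\<dots> = (\<Prod>x\<in>X. cmod (poly (cpoly R) x))"
    unfolding k[symmetric] list by (simp add: prod_norm)
  also have "\<dots> = cmod (poly (cpoly R) \<theta>) * (\<Prod>x\<in>X - {\<theta>}. cmod (poly (cpoly R) x))"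
    using root X by (intro prod.remove) auto
  also have "\<dots> \<le> cmod (poly (cpoly R) \<theta>) * (\<Prod>x\<in>X - {\<theta>}. ?B x)"
    using X bound by (intro mult_left_mono prod_mono) auto
  finally have "1 * ?B \<theta> \<le> cmod (poly (cpoly R) \<theta>) * (\<Prod>x\<in>X - {\<theta>}. ?B x) * ?B \<theta>"
    using B1[of \<theta>] by (intro mult_right_mono) auto
  also have "\<dots> = cmod (poly (cpoly R) \<theta>) * (\<Prod>x\<in>X. ?B x)"
    using root X by (subst (2) prod.remove[of _ \<theta>]) auto
  also have "(\<Prod>x\<in>X. ?B x) = C ^ degree p * mahler_measure p ^ n"
  proof -
    have "mahler_measure p = (\<Prod>x\<in>X. max 1 (cmod x))"
      using mahler_measure_monic_eq[OF cpoly_monic_roots(1)[OF monic]] list by (simp add: xs_def)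
    then show ?thesis by (simp add: prod.distrib prod_power_distrib cardX)
  qed
  finally have *: "?B \<theta> \<le> cmod (poly (cpoly R) \<theta>) * (C ^ degree p * mahler_measure p ^ n)"
    by simp
  have "1 * max 1 (cmod \<theta>) ^ n \<le> ?B \<theta>"
    using C by (intro mult_right_mono) auto
  with * show ?thesis by linarith
qed

section \<open>Subadditive sequences\<close>

text \<open>
  Fekete's lemma; the limit is the infimum \<open>L\<close> of the quotients.  Write \<open>n = q * m + r\<close> with \<open>m\<close> chosen so
  that \<open>f m / m\<close> is close to \<open>L\<close>: subadditivity gives \<open>f n / n \<le> f m / m + C / n\<close>, where \<open>C\<close> bounds
  \<open>f r\<close> for all remainders \<open>r\<close>.
\<close>
lemma fekete_convergent:
  fixes f :: "nat \<Rightarrow> real"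
  assumes nonneg: "\<And>n. f n \<ge> 0" and sub: "\<And>m n. f (m + n) \<le> f m + f n"
  shows "convergent (\<lambda>n. f n / real n)"
proof -
  define L where "L = (INF n\<in>{1..}. f n / real n)"
  have bdd: "bdd_below ((\<lambda>n. f n / real n) ` {1..})"
    by (rule bdd_belowI2[of _ 0]) (simp add: nonneg)
  have lower: "L \<le> f n / real n" if "n \<ge> 1" for n
    unfolding L_def using bdd that by (intro cINF_lower) auto
  have mult: "f (q * m + r) \<le> real q * f m + f r" for q m r
  proof (induction q)
    case (Suc q)
    have "f (Suc q * m + r) = f (m + (q * m + r))" by (simp add: algebra_simps)
    also have "\<dots> \<le> f m + f (q * m + r)" by (rule sub)
    finally show ?case using Suc by (simp add: algebra_simps)
  qed simp
  have "(\<lambda>n. f n / real n) \<longlonglongrightarrow> L"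
  proof (rule LIMSEQ_I)
    fix e :: real assume "e > 0"
    have "\<exists>m\<in>{1..}. f m / real m < L + e / 2"
      using cINF_less_iff[OF _ bdd, of "L + e / 2"] \<open>e > 0\<close> unfolding L_def by simp
    then obtain m where m: "m \<ge> 1" "f m / real m < L + e / 2" by auto
    define C where "C = (\<Sum>r<m. f r)"
    have C: "f r \<le> C" if "r < m" for r
      unfolding C_def using that nonneg by (intro member_le_sum) auto
    have "C \<ge> 0" unfolding C_def by (intro sum_nonneg nonneg)
    obtain N0 :: nat where N0: "real N0 > 2 * C / e" using reals_Archimedean2 by blast
    have "norm (f n / real n - L) < e" if n: "n \<ge> Suc N0" for n
    proof -
      have "real n > 0" using n by simp
      have "f n \<le> real (n div m) * f m + f (n mod m)"
        using mult[of "n div m" m "n mod m"] by (simp only: div_mult_mod_eq)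
      also have "\<dots> \<le> real n / real m * f m + C"
      proof (rule add_mono)
        show "real (n div m) * f m \<le> real n / real m * f m"
          by (rule mult_right_mono[OF of_nat_div_le_of_nat nonneg])
        show "f (n mod m) \<le> C" using m(1) by (intro C) simp
      qed
      finally have "f n / real n \<le> (real n / real m * f m + C) / real n"
        using \<open>real n > 0\<close> by (intro divide_right_mono) auto
      also have "\<dots> = f m / real m + C / real n"
        using \<open>real n > 0\<close> by (simp add: add_divide_distrib)
      finally have "f n / real n \<le> f m / real m + C / real n" .
      moreover have "C / real n < e / 2"
      proof -
        have "2 * C / e < real n" using N0 n by linarith
        then show ?thesis using \<open>e > 0\<close> \<open>real n > 0\<close> by (simp add: field_simps)
      qed
      moreover have "L \<le> f n / real n" using n by (intro lower) simp
      ultimately show ?thesis using m(2) by (simp only: real_norm_def)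
    qed
    then show "\<exists>no. \<forall>n\<ge>no. norm (f n / real n - L) < e" by blast
  qed
  then show ?thesis by (auto simp: convergent_def)
qed

section \<open>Entropy\<close>

context group
begin

lemma foldr_mult_closed:
  "set xs \<subseteq> carrier G \<Longrightarrow> foldr (\<lambda>x y. x \<otimes> y) xs \<one> \<in> carrier G"
  by (induction xs) auto

lemma foldr_mult_append:
  assumes "set xs \<subseteq> carrier G" "set ys \<subseteq> carrier G"
  shows "foldr (\<lambda>x y. x \<otimes> y) (xs @ ys) \<one> =
         foldr (\<lambda>x y. x \<otimes> y) xs \<one> \<otimes> foldr (\<lambda>x y. x \<otimes> y) ys \<one>"
  using assms by (induction xs) (auto simp: foldr_mult_closed m_assoc)

lemma finite_products_upto:
  assumes "finite S"
  shows "finite (products_upto G S n)"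
proof -
  have "products_upto G S n = (\<lambda>xs. foldr (\<lambda>x y. x \<otimes> y) xs \<one>) ` {xs. set xs \<subseteq> S \<and> length xs \<le> n}"
    by (auto simp: products_upto_def)
  then show ?thesis using finite_lists_length_le[OF assms] by simp
qed

lemma card_products_upto_pos:
  assumes "finite S"
  shows "card (products_upto G S n) \<ge> 1"
proof -
  have "\<one> \<in> products_upto G S n"
    unfolding products_upto_def by (auto intro!: exI[of _ "[]"])
  then show ?thesis using finite_products_upto[OF assms]
    by (metis One_nat_def Suc_leI card_gt_0_iff empty_iff)
qed

lemma products_upto_add:
  assumes "S \<subseteq> carrier G"
  shows "products_upto G S (m + n) \<subseteq> (\<lambda>(x, y). x \<otimes> y) ` (products_upto G S m \<times> products_upto G S n)"
proof
  fix x assume "x \<in> products_upto G S (m + n)"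
  then obtain xs where xs: "set xs \<subseteq> S" "length xs \<le> m + n" "x = foldr (\<lambda>x y. x \<otimes> y) xs \<one>"
    by (auto simp: products_upto_def)
  have sub: "set (take m xs) \<subseteq> S" "set (drop m xs) \<subseteq> S"
    using xs(1) set_take_subset set_drop_subset by fast+
  have "x = foldr (\<lambda>x y. x \<otimes> y) (take m xs) \<one> \<otimes> foldr (\<lambda>x y. x \<otimes> y) (drop m xs) \<one>"
    using foldr_mult_append[of "take m xs" "drop m xs"] sub assms xs(3) by auto
  moreover have "foldr (\<lambda>x y. x \<otimes> y) (take m xs) \<one> \<in> products_upto G S m"
    unfolding products_upto_def using sub by force
  moreover have "foldr (\<lambda>x y. x \<otimes> y) (drop m xs) \<one> \<in> products_upto G S n"
    unfolding products_upto_def using sub xs(2) by force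
  ultimately show "x \<in> (\<lambda>(x, y). x \<otimes> y) ` (products_upto G S m \<times> products_upto G S n)" by auto
qed

text \<open>
  Convergence has to be established before anything can be said about the entropy, since the value of
  a non-existent limit is arbitrary.
\<close>
lemma entropy_wrt_limit:
  assumes "finite S" "S \<subseteq> carrier G"
  shows "(\<lambda>n. ln (real (card (products_upto G S n))) / real n) \<longlonglongrightarrow> entropy_wrt G S"
proof -
  let ?c = "\<lambda>n. card (products_upto G S n)"
  have "convergent (\<lambda>n. ln (real (?c n)) / real n)"
  proof (rule fekete_convergent)
    show "ln (real (?c n)) \<ge> 0" for n
      using card_products_upto_pos[OF assms(1), of n] by simp
    show "ln (real (?c (m + n))) \<le> ln (real (?c m)) + ln (real (?c n))" for m n
    proof -
      have "?c (m + n) \<le> card (products_upto G S m \<times> products_upto G S n)"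
        using products_upto_add[OF assms(2), of m n] finite_products_upto[OF assms(1)]
        by (intro surj_card_le[of _ _ "\<lambda>(x, y). x \<otimes> y"]) (simp_all add: finite_cartesian_product)
      then have "real (?c (m + n)) \<le> real (?c m) * real (?c n)"
        by (simp add: card_cartesian_product flip: of_nat_mult)
      moreover have "?c k > 0" for k
        using card_products_upto_pos[OF assms(1), of k] by simp
      ultimately have "ln (real (?c (m + n))) \<le> ln (real (?c m) * real (?c n))"
        by simp
      then show ?thesis using \<open>\<And>k. ?c k > 0\<close> by (simp add: ln_mult)
    qed
  qed
  then show ?thesis
    unfolding entropy_wrt_def by (simp add: convergent_LIMSEQ_iff)
qed

text \<open>The infimum of a set of reals is meaningful only if the set is bounded below, here by 0.\<close>
lemma algebraic_entropy_le:
  assumes "S \<in> sym_generating_sets G"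
  shows "algebraic_entropy G \<le> entropy_wrt G S"
  unfolding algebraic_entropy_def
proof (rule cINF_lower[OF _ assms])
  have "entropy_wrt G S' \<ge> 0" if "S' \<in> sym_generating_sets G" for S'
  proof -
    have S': "finite S'" "S' \<subseteq> carrier G" using that by (auto simp: sym_generating_sets_def)
    have "ln (real (card (products_upto G S' n))) / real n \<ge> 0" for n
      using card_products_upto_pos[OF S'(1), of n] by simp
    then show ?thesis
      using entropy_wrt_limit[OF S'] by (intro LIMSEQ_le_const) auto
  qed
  then show "bdd_below (entropy_wrt G ` sym_generating_sets G)"
    by (intro bdd_belowI2[of _ 0])
qed

text \<open>Pigeonhole: two powers of \<open>x\<close> lie in the same coset.\<close>
lemma finite_index_power:
  assumes H: "subgroup H G" and fin: "finite (rcosets H)" and x: "x \<in> carrier G"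
  shows "\<exists>m>0. x [^] (m::nat) \<in> H"
proof -
  have "(\<lambda>i::nat. H #> (x [^] i)) ` UNIV \<subseteq> rcosets H"
    using x by (auto intro!: rcosetsI[OF subgroup.subset[OF H]])
  then have "finite (range (\<lambda>i::nat. H #> (x [^] i)))"
    using fin finite_subset by blast
  then have "\<not> inj (\<lambda>i::nat. H #> (x [^] i))"
    using range_inj_infinite by blast
  then obtain i j :: nat where ij: "i < j" "H #> (x [^] i) = H #> (x [^] j)"
    unfolding inj_def by (metis linorder_neqE_nat)
  then have "x [^] j \<in> H #> (x [^] i)"
    using repr_independenceD[OF H] x by auto
  then obtain h where h: "h \<in> H" "x [^] j = h \<otimes> x [^] i"
    by (auto simp: r_coset_def)
  have "x [^] (j - i) \<otimes> x [^] i = h \<otimes> x [^] i"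
    using ij x h by (simp add: nat_pow_mult)
  then have "x [^] (j - i) = h"
    using x h(1) subgroup.mem_carrier[OF H] by (meson nat_pow_closed r_cancel)
  then show ?thesis using ij h by (intro exI[of _ "j - i"]) auto
qed

end

section \<open>Counting separated points\<close>

text \<open>
  A grid of squares with side \<open>\<delta> / 2\<close> has at most one of the points in each cell, because two points in
  the same cell are at distance less than \<open>\<delta>\<close>.
\<close>
lemma card_separated_points_le:
  fixes A :: "complex set"
  assumes \<delta>: "\<delta> > 0" and r: "r \<ge> 0" and bound: "\<And>z. z \<in> A \<Longrightarrow> cmod z \<le> r"
    and sep: "\<And>z w. z \<in> A \<Longrightarrow> w \<in> A \<Longrightarrow> z \<noteq> w \<Longrightarrow> \<delta> \<le> cmod (z - w)"
  shows "finite A \<and> real (card A) \<le> (4 * r / \<delta> + 3)\<^sup>2"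
proof -
  define M :: int where "M = \<lceil>2 * r / \<delta>\<rceil>"
  define g where "g z = (\<lfloor>2 * Re z / \<delta>\<rfloor>, \<lfloor>2 * Im z / \<delta>\<rfloor>)" for z
  have floor_close: "\<bar>a - b\<bar> < \<delta> / 2" if "\<lfloor>2 * a / \<delta>\<rfloor> = \<lfloor>2 * b / \<delta>\<rfloor>" for a b
  proof -
    have "\<bar>2 * a / \<delta> - 2 * b / \<delta>\<bar> < 1"
      using that floor_correct[of "2 * a / \<delta>"] floor_correct[of "2 * b / \<delta>"] by linarith
    moreover have "\<bar>2 * a / \<delta> - 2 * b / \<delta>\<bar> = 2 * \<bar>a - b\<bar> / \<delta>"
      using \<delta> by (simp add: abs_if diff_divide_distrib[symmetric] field_simps)
    ultimately show ?thesis using \<delta> by (simp add: field_simps)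
  qed
  have inj: "inj_on g A"
  proof (rule inj_onI, rule ccontr)
    fix z w assume zw: "z \<in> A" "w \<in> A" "g z = g w" "z \<noteq> w"
    then have "\<bar>Re (z - w)\<bar> < \<delta> / 2" "\<bar>Im (z - w)\<bar> < \<delta> / 2"
      using floor_close by (auto simp: g_def)
    then have "cmod (z - w) < \<delta>" using cmod_le[of "z - w"] by linarith
    with sep zw show False by force
  qed
  have floor_range: "\<lfloor>2 * a / \<delta>\<rfloor> \<in> {-M..M}" if "\<bar>a\<bar> \<le> r" for a
  proof -
    have "2 * a / \<delta> \<le> 2 * r / \<delta>" "- (2 * r / \<delta>) \<le> 2 * a / \<delta>"
      using \<delta> that by (simp_all add: field_simps)
    then have "- M \<le> \<lfloor>2 * a / \<delta>\<rfloor>" "\<lfloor>2 * a / \<delta>\<rfloor> \<le> M"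
      using le_of_int_ceiling[of "2 * r / \<delta>"] floor_mono[of "2 * a / \<delta>" "2 * r / \<delta>"]
        floor_le_ceiling[of "2 * r / \<delta>"]
      unfolding M_def le_floor_iff of_int_minus by linarith+
    then show ?thesis by simp
  qed
  have img: "g ` A \<subseteq> {-M..M} \<times> {-M..M}"
  proof
    fix y assume "y \<in> g ` A"
    then obtain z where z: "z \<in> A" "y = g z" by auto
    have "\<bar>Re z\<bar> \<le> r" "\<bar>Im z\<bar> \<le> r"
      using bound[OF z(1)] abs_Re_le_cmod[of z] abs_Im_le_cmod[of z] by linarith+
    then show "y \<in> {-M..M} \<times> {-M..M}"
      unfolding z(2) g_def using floor_range by blast
  qed
  have "finite A" using img inj by (meson finite_SigmaI finite_atLeastAtMost_int finite_imageD finite_subset)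
  have M0: "M \<ge> 0" using r \<delta> by (simp add: M_def less_le_trans[of "-1" 0])
  have "card A = card (g ` A)" using inj by (simp add: card_image)
  also have "\<dots> \<le> card ({-M..M} \<times> {-M..M})" by (rule card_mono[OF _ img]) auto
  also have "\<dots> = (nat (2 * M + 1))\<^sup>2" by (simp add: card_cartesian_product power2_eq_square)
  finally have "real (card A) \<le> real ((nat (2 * M + 1))\<^sup>2)" by (simp only: of_nat_le_iff)
  also have "\<dots> = (real_of_int (2 * M + 1))\<^sup>2" using M0 by simp
  also have "\<dots> \<le> (4 * r / \<delta> + 3)\<^sup>2"
  proof (rule power_mono)
    have "real_of_int M \<le> 2 * r / \<delta> + 1" unfolding M_def by linarith
    then show "real_of_int (2 * M + 1) \<le> 4 * r / \<delta> + 3" by simp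
  qed (use M0 in simp)
  finally show ?thesis using \<open>finite A\<close> by simp
qed

section \<open>Groups of complex affine maps\<close>

text \<open>The pair \<open>(a, b)\<close> stands for the map \<open>z \<mapsto> a * z + b\<close>, and the product is composition.\<close>
definition affine_group :: "(complex \<times> complex) monoid" where
  "affine_group = \<lparr>carrier = {f. fst f \<noteq> 0},
     monoid.mult = (\<lambda>f g. (fst f * fst g, fst f * snd g + snd f)), one = (1, 0)\<rparr>"

lemma group_affine_group: "group affine_group"
proof (rule groupI)
  fix f assume "f \<in> carrier affine_group"
  then show "\<exists>g\<in>carrier affine_group. g \<otimes>\<^bsub>affine_group\<^esub> f = \<one>\<^bsub>affine_group\<^esub>"
    by (intro bexI[of _ "(1 / fst f, - snd f / fst f)"]) (auto simp: affine_group_def)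
qed (auto simp: affine_group_def algebra_simps)

text \<open>
  The group generated by \<open>z \<mapsto> \<theta> * z\<close> and \<open>z \<mapsto> z + 1\<close>, as an abstract group \<open>G\<close> with a faithful affine
  representation \<open>\<psi>\<close>.  Its elements are compared through their values under \<open>\<psi>\<close>, so that all
  properties can be proved directly for a copy of this group with carrier in the natural numbers.
\<close>
locale affine_embedding = group_hom G affine_group \<psi> for G (structure) and \<psi> +
  fixes \<theta> :: complex and t u
  assumes inj: "inj_on \<psi> (carrier G)"
    and expanding: "cmod \<theta> > 1"
    and t_closed [simp]: "t \<in> carrier G" and u_closed [simp]: "u \<in> carrier G"
    and \<psi>_t: "\<psi> t = (\<theta>, 0)" and \<psi>_u: "\<psi> u = (1, 1)"
    and generate_tu: "generate G {t, u} = carrier G"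
begin

abbreviation lin where "lin x \<equiv> fst (\<psi> x)"
abbreviation transl where "transl x \<equiv> snd (\<psi> x)"

text \<open>Values under \<open>\<psi>\<close> are computed componentwise by the rules below instead.\<close>
declare hom_one [simp del] hom_mult [simp del] hom_inv [simp del]

lemma theta_nz: "\<theta> \<noteq> 0"
  using expanding by auto

lemma lin_nz: "x \<in> carrier G \<Longrightarrow> lin x \<noteq> 0"
  using hom_closed[of x] by (simp add: affine_group_def)

lemma affine_eqI:
  "x \<in> carrier G \<Longrightarrow> y \<in> carrier G \<Longrightarrow> lin x = lin y \<Longrightarrow> transl x = transl y \<Longrightarrow> x = y"
  using inj by (simp add: inj_on_def prod_eq_iff)

lemma one_parts: "lin \<one> = 1" "transl \<one> = 0"
  using hom_one by (simp_all add: affine_group_def)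

lemma mult_parts:
  assumes "x \<in> carrier G" "y \<in> carrier G"
  shows "lin (x \<otimes> y) = lin x * lin y" "transl (x \<otimes> y) = lin x * transl y + transl x"
  using hom_mult[OF assms] by (simp_all add: affine_group_def)

lemma inv_parts:
  assumes x: "x \<in> carrier G"
  shows "lin (inv x) = 1 / lin x" "transl (inv x) = - transl x / lin x"
proof -
  have "lin x * lin (inv x) = 1" "lin x * transl (inv x) + transl x = 0"
    using mult_parts[OF x, of "inv x"] x one_parts by simp_all
  then show "lin (inv x) = 1 / lin x" "transl (inv x) = - transl x / lin x"
    using lin_nz[OF x] by (simp_all add: field_simps eq_neg_iff_add_eq_0)
qed

lemma t_pow: "lin (t [^] (n::nat)) = \<theta> ^ n" "transl (t [^] (n::nat)) = 0"
  by (induction n) (auto simp: one_parts mult_parts \<psi>_t)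

lemma u_pow: "lin (u [^] (n::nat)) = 1" "transl (u [^] (n::nat)) = of_nat n"
  by (induction n) (auto simp: one_parts mult_parts \<psi>_u)

text \<open>The translations form an abelian normal subgroup, and commutators have multiplier 1.\<close>
lemma metabelian: "metabelian_group G"
proof -
  define N where "N = {x \<in> carrier G. lin x = 1}"
  have sub: "subgroup N G"
    by (rule subgroup.intro) (auto simp: N_def one_parts mult_parts inv_parts)
  have normal: "N \<lhd> G"
  proof (rule G.normal_invI[OF sub])
    fix x h assume "x \<in> carrier G" "h \<in> N"
    then show "x \<otimes> h \<otimes> inv x \<in> N"
      using lin_nz[of x] by (simp add: N_def mult_parts inv_parts)
  qed
  have "comm_group (G\<lparr>carrier := N\<rparr>)"
  proof (rule group.group_comm_groupI)
    show "group (G\<lparr>carrier := N\<rparr>)" by (rule G.subgroup_imp_group[OF sub])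
    fix x y assume "x \<in> carrier (G\<lparr>carrier := N\<rparr>)" "y \<in> carrier (G\<lparr>carrier := N\<rparr>)"
    then have "x \<in> carrier G" "y \<in> carrier G" "lin x = 1" "lin y = 1" by (auto simp: N_def)
    then have "x \<otimes> y = y \<otimes> x" by - (rule affine_eqI, simp_all add: mult_parts)
    then show "x \<otimes>\<^bsub>G\<lparr>carrier := N\<rparr>\<^esub> y = y \<otimes>\<^bsub>G\<lparr>carrier := N\<rparr>\<^esub> x" by simp
  qed
  moreover have "comm_group (G Mod N)"
  proof (rule group.group_comm_groupI)
    show "group (G Mod N)" by (rule normal.factorgroup_is_group[OF normal])
    fix X Y assume "X \<in> carrier (G Mod N)" "Y \<in> carrier (G Mod N)"
    then obtain x y where xy: "x \<in> carrier G" "y \<in> carrier G" "X = N #> x" "Y = N #> y"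
      unfolding carrier_FactGroup by blast
    have "x \<otimes> y \<otimes> inv (y \<otimes> x) \<in> N"
      using xy(1,2) lin_nz[OF xy(1)] lin_nz[OF xy(2)] by (simp add: N_def mult_parts inv_parts)
    moreover have "x \<otimes> y = (x \<otimes> y \<otimes> inv (y \<otimes> x)) \<otimes> (y \<otimes> x)"
      using xy(1,2) by - (rule affine_eqI, simp_all add: mult_parts inv_parts lin_nz)
    ultimately have "x \<otimes> y \<in> N #> (y \<otimes> x)"
      unfolding r_coset_def by blast
    then have "N #> (y \<otimes> x) = N #> (x \<otimes> y)"
      using xy(1,2) by (intro G.repr_independence[OF _ _ sub]) simp_all
    then show "X \<otimes>\<^bsub>G Mod N\<^esub> Y = Y \<otimes>\<^bsub>G Mod N\<^esub> X"
      using xy(1,2) unfolding xy(3,4) mult_FactGroup by (simp add: normal.rcos_sum[OF normal])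
  qed
  ultimately show ?thesis using normal unfolding metabelian_group_def by blast
qed

text \<open>
  A subgroup of finite index contains \<open>s = t ^ k\<close> and the nontrivial translation \<open>u ^ m\<close>.  Taking the commutator
  with \<open>s\<close> multiplies a translation by \<open>1 - \<theta> ^ k\<close>, which is nonzero as \<open>\<bar>\<theta>\<bar> > 1\<close>, so every term of
  the lower central series contains a nontrivial translation.
\<close>
lemma not_virtually_nilpotent: "\<not> virtually_nilpotent_group G"
proof
  assume "virtually_nilpotent_group G"
  then obtain H where H: "subgroup H G" "finite (rcosets H)" "nilpotent_group (G\<lparr>carrier := H\<rparr>)"
    by (auto simp: virtually_nilpotent_group_def)
  interpret H: subgroup H G by (rule H(1))
  obtain k :: nat where k: "k > 0" "t [^] k \<in> H" using G.finite_index_power[OF H(1,2) t_closed] by auto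
  obtain m :: nat where m: "m > 0" "u [^] m \<in> H" using G.finite_index_power[OF H(1,2) u_closed] by auto
  define s where "s = t [^] k"
  have s: "s \<in> H" "s \<in> carrier G" using k by (auto simp: s_def)
  have "cmod (\<theta> ^ k) > 1" using expanding k by (simp add: norm_power one_less_power)
  then have ne: "\<theta> ^ k \<noteq> 1" by auto
  have "\<exists>x. x \<in> H \<and> x \<in> lower_central_series (G\<lparr>carrier := H\<rparr>) n \<and> lin x = 1 \<and> transl x \<noteq> 0" for n
  proof (induction n)
    case 0
    show ?case using m by (intro exI[of _ "u [^] m"]) (auto simp: u_pow)
  next
    case (Suc n)
    then obtain x where x: "x \<in> H" "x \<in> lower_central_series (G\<lparr>carrier := H\<rparr>) n"
      "lin x = 1" "transl x \<noteq> 0" by blast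
    have xG: "x \<in> carrier G" using x(1) by auto
    define y where "y = x \<otimes> s \<otimes> inv x \<otimes> inv s"
    have "y \<in> H" unfolding y_def using x s by auto
    moreover have "y \<in> lower_central_series (G\<lparr>carrier := H\<rparr>) (Suc n)"
    proof -
      have "y = x \<otimes> s \<otimes> inv\<^bsub>G\<lparr>carrier := H\<rparr>\<^esub> x \<otimes> inv\<^bsub>G\<lparr>carrier := H\<rparr>\<^esub> s"
        using x(1) s(1) by (simp add: y_def G.m_inv_consistent[OF H(1)])
      then show ?thesis
        unfolding lower_central_series.simps using x(2) s(1) by (intro generate.incl) auto
    qed
    moreover have "lin y = 1" "transl y = (1 - \<theta> ^ k) * transl x"
      using xG s x(3) theta_nz
      by (auto simp: y_def mult_parts inv_parts s_def t_pow algebra_simps)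
    ultimately show ?case using ne x(4) by (intro exI[of _ y]) auto
  qed
  moreover obtain n where "lower_central_series (G\<lparr>carrier := H\<rparr>) n = {\<one>}"
    using H(3) by (auto simp: nilpotent_group_def)
  ultimately show False using one_parts(2) by (metis singletonD)
qed

definition gens where "gens = {\<one>, t, inv t, u, inv u}"

lemma gens_sym: "gens \<in> sym_generating_sets G"
proof -
  have sub: "gens \<subseteq> carrier G" by (auto simp: gens_def)
  have "generate G {t, u} \<subseteq> generate G gens" by (intro G.mono_generate) (auto simp: gens_def)
  then have "generate G gens = carrier G"
    using G.generate_incl[OF sub] generate_tu by blast
  moreover have "\<forall>s\<in>gens. inv s \<in> gens" by (simp add: gens_def)
  ultimately show ?thesis using sub by (simp add: sym_generating_sets_def) (simp add: gens_def)
qed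

lemma finitely_generated: "finitely_generated_group G"
  unfolding finitely_generated_group_def
  by (intro conjI exI[of _ "{t, u}"] G.is_group generate_tu) simp_all

text \<open>
  Appending \<open>u\<close> or its inverse to a word with multiplier \<open>\<theta> ^ k\<close> changes the translation part by
  \<open>\<theta> ^ k\<close> or \<open>- \<theta> ^ k\<close>, and \<open>\<bar>k\<bar> \<le> N\<close>.  So \<open>\<theta> ^ N\<close> times the translation part is a sum of at most
  \<open>length xs\<close> signed powers \<open>\<theta> ^ j\<close> with \<open>0 \<le> j \<le> 2 * N\<close>.  The bound on \<open>P\<close> is stated at all complex
  points because it will be used at all conjugates of \<open>\<theta>\<close> at once.
\<close>
lemma word_parts:
  assumes "set xs \<subseteq> gens" "length xs \<le> N"
  shows "\<exists>(k::int) P :: int poly. \<bar>k\<bar> \<le> int (length xs) \<and>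
     lin (foldr (\<lambda>x y. x \<otimes> y) xs \<one>) = \<theta> powi k \<and>
     \<theta> ^ N * transl (foldr (\<lambda>x y. x \<otimes> y) xs \<one>) = poly (map_poly of_int P) \<theta> \<and>
     (\<forall>\<mu>::complex. cmod (poly (map_poly of_int P) \<mu>) \<le> real (length xs) * max 1 (cmod \<mu>) ^ (2 * N))"
  using assms
proof (induction xs rule: rev_induct)
  case Nil
  show ?case by (intro exI[of _ 0]) (simp add: one_parts)
next
  case (snoc s xs)
  define w where "w = foldr (\<lambda>x y. x \<otimes> y) xs \<one>"
  define n where "n = length xs"
  have s: "s \<in> gens" and xs: "set xs \<subseteq> gens" "Suc n \<le> N" using snoc.prems by (auto simp: n_def)
  have sub: "gens \<subseteq> carrier G" by (auto simp: gens_def)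
  have sG: "s \<in> carrier G" and xsG: "set xs \<subseteq> carrier G" using s xs sub by auto
  have w: "w \<in> carrier G" unfolding w_def by (rule G.foldr_mult_closed[OF xsG])
  have word: "foldr (\<lambda>x y. x \<otimes> y) (xs @ [s]) \<one> = w \<otimes> s"
    using G.foldr_mult_append[OF xsG, of "[s]"] sG by (simp add: w_def)
  obtain k P where k: "\<bar>k\<bar> \<le> int n" "lin w = \<theta> powi k"
    and P: "\<theta> ^ N * transl w = poly (map_poly of_int P) \<theta>"
      "\<And>\<mu>::complex. cmod (poly (map_poly of_int P) \<mu>) \<le> real n * max 1 (cmod \<mu>) ^ (2 * N)"
    using snoc.IH xs by (auto simp: w_def n_def)
  have ex: "\<exists>(e::int) c :: int. \<bar>e\<bar> \<le> 1 \<and> \<bar>c\<bar> \<le> 1 \<and> lin s = \<theta> powi e \<and> transl s = of_int c"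
  proof -
    consider "s = \<one>" | "s = t" | "s = inv t" | "s = u" | "s = inv u"
      using s by (auto simp: gens_def)
    then show ?thesis
    proof cases
      case 1 then show ?thesis by (intro exI[of _ 0]) (simp add: one_parts)
    next
      case 2 then show ?thesis by (intro exI[of _ 1] exI[of _ 0]) (simp add: \<psi>_t)
    next
      case 3 then show ?thesis
        by (intro exI[of _ "-1"] exI[of _ 0]) (simp add: \<psi>_t inv_parts power_int_minus divide_inverse)
    next
      case 4 then show ?thesis by (intro exI[of _ 0] exI[of _ 1]) (simp add: \<psi>_u)
    next
      case 5 then show ?thesis by (intro exI[of _ 0] exI[of _ "-1"]) (simp add: \<psi>_u inv_parts)
    qed
  qed
  then obtain e c :: int where ec: "\<bar>e\<bar> \<le> 1" "\<bar>c\<bar> \<le> 1" "lin s = \<theta> powi e" "transl s = of_int c" by blast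
  define j where "j = nat (int N + k)"
  have j: "int j = int N + k" "j \<le> 2 * N" using k xs by (auto simp: j_def)
  define P' where "P' = P + monom c j"
  have ev: "poly (map_poly of_int P') x = poly (map_poly of_int P) x + of_int c * x ^ j" for x :: complex
    by (simp add: P'_def hom_distribs poly_monom)
  have "\<theta> ^ N * \<theta> powi k = \<theta> ^ j"
  proof -
    have "\<theta> ^ N * \<theta> powi k = \<theta> powi (int N + k)"
      using theta_nz by (simp add: power_int_add)
    then show ?thesis by (simp flip: j(1))
  qed
  then have "\<theta> ^ N * (lin w * of_int c + transl w) = poly (map_poly of_int P') \<theta>"
    using P(1) by (simp add: ev k(2) algebra_simps)
  then have 1: "\<theta> ^ N * transl (w \<otimes> s) = poly (map_poly of_int P') \<theta>"
    using w sG ec(4) by (simp add: mult_parts)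
  have 2: "lin (w \<otimes> s) = \<theta> powi (k + e)"
    using w sG ec(3) k(2) theta_nz by (simp add: mult_parts power_int_add)
  have 3: "cmod (poly (map_poly of_int P') \<mu>) \<le> real (Suc n) * max 1 (cmod \<mu>) ^ (2 * N)" for \<mu> :: complex
  proof -
    have "cmod (poly (map_poly of_int P') \<mu>) \<le> cmod (poly (map_poly of_int P) \<mu>) + cmod (of_int c * \<mu> ^ j)"
      unfolding ev by (rule norm_triangle_ineq)
    moreover have "cmod (of_int c * \<mu> ^ j) \<le> 1 * max 1 (cmod \<mu>) ^ (2 * N)"
      unfolding norm_mult norm_power
    proof (rule mult_mono)
      show "cmod (of_int c) \<le> 1" using ec(2) by (simp del: of_int_abs add: of_int_abs[symmetric])
      have "cmod \<mu> ^ j \<le> max 1 (cmod \<mu>) ^ j" by (intro power_mono) auto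
      also have "\<dots> \<le> max 1 (cmod \<mu>) ^ (2 * N)" using j(2) by (intro power_increasing) auto
      finally show "cmod \<mu> ^ j \<le> max 1 (cmod \<mu>) ^ (2 * N)" .
    qed auto
    ultimately show ?thesis using P(2)[of \<mu>] by (simp add: algebra_simps)
  qed
  have "\<bar>k + e\<bar> \<le> int (Suc n)" using k(1) ec(1) by auto
  then show ?case unfolding word using 1 2 3 by (intro exI[of _ "k + e"] exI[of _ P']) (simp add: n_def)
qed

end

text \<open>
  The subgroup of the affine group is countable, so it has an isomorphic copy on natural numbers, and
  \<open>\<psi>\<close> is the isomorphism back.
\<close>
lemma affine_embedding_exists:
  assumes "cmod \<theta> > 1"
  shows "\<exists>(K :: nat monoid) \<psi> t u. affine_embedding K \<psi> \<theta> t u"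
proof -
  interpret A: group affine_group by (rule group_affine_group)
  have [simp]: "\<theta> \<noteq> 0" using assms by auto
  define S where "S = {(\<theta>, 0), (1 :: complex, 1 :: complex)}"
  define C where "C = generate affine_group S"
  define G where "G = affine_group\<lparr>carrier := C\<rparr>"
  have S: "S \<subseteq> carrier affine_group" by (auto simp: S_def affine_group_def)
  have sub: "subgroup C affine_group" unfolding C_def by (rule A.generate_is_subgroup[OF S])
  have SC: "S \<subseteq> C" unfolding C_def by (auto intro: generate.incl)
  have G: "group G" unfolding G_def by (rule A.subgroup_imp_group[OF sub])
  have gen: "generate G S = carrier G"
    using A.generate_consistent[OF SC sub] by (simp add: G_def C_def)
  have "finitely_generated_group G"
    unfolding finitely_generated_group_def using G gen SC
    by (intro conjI exI[of _ S]) (auto simp: S_def G_def)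
  then obtain K :: "nat monoid" where K: "group K" "G \<cong> K"
    using finitely_generated_group_iso_nat by blast
  then obtain \<psi> where \<psi>: "\<psi> \<in> iso K G"
    using group.iso_sym[OF G] by (auto simp: is_iso_def)
  then have hom: "\<psi> \<in> hom K G" and bij: "bij_betw \<psi> (carrier K) (carrier G)"
    by (auto simp: iso_def)
  interpret KG: group_hom K G \<psi>
    using K(1) G hom by (simp add: group_hom_def group_hom_axioms_def)
  have "hom K G \<subseteq> hom K affine_group"
    using subgroup.subset[OF sub] by (auto simp: hom_def G_def)
  then have hom': "\<psi> \<in> hom K affine_group" using hom by auto
  obtain t u where t: "t \<in> carrier K" "\<psi> t = (\<theta>, 0)" and u: "u \<in> carrier K" "\<psi> u = (1, 1)"
    using bij SC unfolding bij_betw_def S_def G_def by auto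
  have "\<psi> ` generate K {t, u} = generate G (\<psi> ` {t, u})"
    using t u by (subst KG.generate_img) auto
  also have "\<dots> = \<psi> ` carrier K"
    using t u gen bij by (simp add: S_def bij_betw_def)
  finally have "generate K {t, u} = carrier K"
    using bij t u KG.G.generate_incl[of "{t, u}"]
    by (subst (asm) inj_on_image_eq_iff[of \<psi> "carrier K"]) (auto simp: bij_betw_def)
  then have "affine_embedding K \<psi> \<theta> t u"
    using K(1) hom' group_affine_group assms t u bij
    by (auto simp: affine_embedding_def affine_embedding_axioms_def group_hom_def
        group_hom_axioms_def bij_betw_def)
  then show ?thesis by blast
qed

section \<open>Small entropy from small Mahler measure\<close>

text \<open>
  A word of length at most \<open>N\<close> is determined by its multiplier, for which there are at most
  \<open>2 * N + 1\<close> choices, and by its translation part, which after multiplication by \<open>\<theta> ^ N\<close> is one of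
  the algebraic integers \<open>P(\<theta>)\<close> with \<open>\<bar>P(\<mu>)\<bar> \<le> N * max 1 \<bar>\<mu>\<bar> ^ (2 * N)\<close> at every \<open>\<mu>\<close>.  These values lie
  in a disc of radius \<open>N * \<bar>\<theta>\<bar> ^ (2 * N)\<close>, and by the Liouville bound applied to differences they
  are separated by \<open>\<bar>\<theta>\<bar> ^ (2 * N) / ((2 * N) ^ degree p * m(p) ^ (2 * N))\<close>.  The factor \<open>\<bar>\<theta>\<bar> ^ (2 * N)\<close>
  cancels in the ratio of the two, so only the Mahler measure is left.  The square comes from
  counting in the plane; it only costs a factor 2 in the entropy bound.
\<close>
lemma (in affine_embedding) card_products_upto_gens_le:
  fixes p :: "int poly"
  assumes irr: "irreducible\<^sub>d p" and monic: "lead_coeff p = 1" and root: "poly (cpoly p) \<theta> = 0"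
    and N: "N \<ge> 1"
  shows "real (card (products_upto G gens N)) \<le>
    (2 * real N + 1) * (4 * (real N * (2 * real N) ^ degree p * mahler_measure p ^ (2 * N)) + 3)\<^sup>2"
proof -
  define A where "A = {poly (cpoly P) \<theta> | P.
    \<forall>\<mu>::complex. cmod (poly (cpoly P) \<mu>) \<le> real N * max 1 (cmod \<mu>) ^ (2 * N)}"
  define M where "M = (2 * real N) ^ degree p * mahler_measure p ^ (2 * N)"
  define \<delta> where "\<delta> = cmod \<theta> ^ (2 * N) / M"
  define r where "r = real N * cmod \<theta> ^ (2 * N)"
  have max_theta: "max 1 (cmod \<theta>) = cmod \<theta>" using expanding by simp
  have theta_pos: "cmod \<theta> > 0" using expanding by linarith
  have "M > 0"
    using mahler_measure_monic_ge_1[OF monic] N unfolding M_def by (intro mult_pos_pos zero_less_power) auto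
  have "finite A \<and> real (card A) \<le> (4 * r / \<delta> + 3)\<^sup>2"
  proof (rule card_separated_points_le)
    show "\<delta> > 0" using \<open>M > 0\<close> theta_pos by (simp add: \<delta>_def)
    show "r \<ge> 0" by (simp add: r_def)
    show "cmod z \<le> r" if z: "z \<in> A" for z
    proof -
      obtain P where "z = poly (cpoly P) \<theta>"
          "\<And>\<mu>::complex. cmod (poly (cpoly P) \<mu>) \<le> real N * max 1 (cmod \<mu>) ^ (2 * N)"
        using z unfolding A_def by blast
      then show ?thesis using max_theta unfolding r_def by metis
    qed
    show "\<delta> \<le> cmod (z - w)" if zw: "z \<in> A" "w \<in> A" "z \<noteq> w" for z w
    proof -
      obtain P Q where P: "z = poly (cpoly P) \<theta>"
          "\<And>\<mu>::complex. cmod (poly (cpoly P) \<mu>) \<le> real N * max 1 (cmod \<mu>) ^ (2 * N)"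
        and Q: "w = poly (cpoly Q) \<theta>"
          "\<And>\<mu>::complex. cmod (poly (cpoly Q) \<mu>) \<le> real N * max 1 (cmod \<mu>) ^ (2 * N)"
        using zw(1,2) unfolding A_def by blast
      have diff: "poly (cpoly (P - Q)) x = poly (cpoly P) x - poly (cpoly Q) x" for x :: complex
        by (simp add: hom_distribs)
      have "max 1 (cmod \<theta>) ^ (2 * N)
            \<le> cmod (poly (cpoly (P - Q)) \<theta>) * ((2 * real N) ^ degree p * mahler_measure p ^ (2 * N))"
      proof (rule liouville_separation[OF irr monic root])
        show "poly (cpoly (P - Q)) \<theta> \<noteq> 0" using zw(3) P(1) Q(1) diff by simp
        show "1 \<le> 2 * real N" using N by simp
        show "cmod (poly (cpoly (P - Q)) \<mu>) \<le> 2 * real N * max 1 (cmod \<mu>) ^ (2 * N)" for \<mu>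
          using norm_triangle_ineq4[of "poly (cpoly P) \<mu>" "poly (cpoly Q) \<mu>"] P(2)[of \<mu>] Q(2)[of \<mu>]
          unfolding diff by linarith
      qed
      then have "cmod \<theta> ^ (2 * N) \<le> cmod (z - w) * M"
        using P(1) Q(1) diff max_theta by (simp add: M_def)
      then show ?thesis using \<open>M > 0\<close> by (simp add: \<delta>_def divide_le_eq)
    qed
  qed
  then have finA: "finite A" and cardA: "real (card A) \<le> (4 * r / \<delta> + 3)\<^sup>2" by auto
  have ratio: "r / \<delta> = real N * M"
    using theta_pos \<open>M > 0\<close> by (simp add: r_def \<delta>_def)
  \<comment> \<open>The factor \<open>\<theta> ^ N\<close> clears the negative powers of \<open>\<theta>\<close> in the translation part.\<close>
  define g where "g x = (lin x, \<theta> ^ N * transl x)" for x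
  have gens_sub: "gens \<subseteq> carrier G" by (simp add: gens_def)
  have prod_sub: "products_upto G gens N \<subseteq> carrier G"
  proof
    fix x assume "x \<in> products_upto G gens N"
    then obtain xs where "set xs \<subseteq> gens" "x = foldr (\<lambda>x y. x \<otimes> y) xs \<one>"
      unfolding products_upto_def by blast
    then show "x \<in> carrier G" using G.foldr_mult_closed[of xs] gens_sub by blast
  qed
  have "inj_on g (products_upto G gens N)"
  proof (rule inj_onI)
    fix x y assume xy: "x \<in> products_upto G gens N" "y \<in> products_upto G gens N" "g x = g y"
    have "lin x = lin y" "transl x = transl y" using xy(3) theta_nz by (simp_all add: g_def)
    with xy(1,2) prod_sub show "x = y" by (metis affine_eqI subsetD)
  qed
  then have "card (products_upto G gens N) = card (g ` products_upto G gens N)"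
    by (simp add: card_image)
  also have "\<dots> \<le> card (((\<lambda>k. \<theta> powi k) ` {- int N..int N}) \<times> A)"
  proof (rule card_mono)
    show "finite (((\<lambda>k. \<theta> powi k) ` {- int N..int N}) \<times> A)" using finA by simp
    show "g ` products_upto G gens N \<subseteq> ((\<lambda>k. \<theta> powi k) ` {- int N..int N}) \<times> A"
    proof
      fix y assume "y \<in> g ` products_upto G gens N"
      then obtain xs where xs: "set xs \<subseteq> gens" "length xs \<le> N" "y = g (foldr (\<lambda>x y. x \<otimes> y) xs \<one>)"
        unfolding products_upto_def by blast
      from word_parts[OF xs(1,2)] obtain k P where k: "\<bar>k\<bar> \<le> int (length xs)"
        and y: "y = (\<theta> powi k, poly (cpoly P) \<theta>)"
        and P: "\<And>\<mu>::complex. cmod (poly (cpoly P) \<mu>) \<le> real (length xs) * max 1 (cmod \<mu>) ^ (2 * N)"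
        unfolding xs(3) g_def by auto
      have "cmod (poly (cpoly P) \<mu>) \<le> real N * max 1 (cmod \<mu>) ^ (2 * N)" for \<mu> :: complex
        using P[of \<mu>] xs(2) by (elim order.trans) (intro mult_right_mono, auto)
      then have "poly (cpoly P) \<theta> \<in> A" unfolding A_def by blast
      moreover have "k \<in> {- int N..int N}" using k xs(2) by auto
      ultimately show "y \<in> ((\<lambda>k. \<theta> powi k) ` {- int N..int N}) \<times> A" unfolding y by blast
    qed
  qed
  also have "\<dots> = card ((\<lambda>k. \<theta> powi k) ` {- int N..int N}) * card A"
    by (rule card_cartesian_product)
  also have "\<dots> \<le> card {- int N..int N} * card A"
    by (intro mult_right_mono card_image_le) auto
  also have "card {- int N..int N} = 2 * N + 1" by simp
  finally have "real (card (products_upto G gens N)) \<le> real ((2 * N + 1) * card A)"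
    by (simp only: of_nat_le_iff)
  also have "\<dots> = (2 * real N + 1) * real (card A)" by (simp add: algebra_simps)
  also have "\<dots> \<le> (2 * real N + 1) * (4 * r / \<delta> + 3)\<^sup>2"
    using cardA by (intro mult_left_mono) auto
  also have "4 * r / \<delta> = 4 * (real N * M)" using ratio by (metis times_divide_eq_right)
  finally show ?thesis by (simp add: M_def mult.assoc)
qed

text \<open>
  In the word count everything except \<open>m(p) ^ (4 * N)\<close> is polynomial in \<open>N\<close>, so it disappears in the
  exponential growth rate.
\<close>
lemma (in affine_embedding) entropy_le_mahler:
  fixes p :: "int poly"
  assumes irr: "irreducible\<^sub>d p" and monic: "lead_coeff p = 1" and root: "poly (cpoly p) \<theta> = 0"
  shows "algebraic_entropy G \<le> 4 * ln (mahler_measure p)"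
proof -
  define m d where "m = mahler_measure p" and "d = degree p"
  have m: "m \<ge> 1" unfolding m_def by (rule mahler_measure_monic_ge_1[OF monic])
  have gens: "finite gens" "gens \<subseteq> carrier G"
    using gens_sym by (auto simp: sym_generating_sets_def)
  define F where "F N = (ln (2 * real N + 1) + 2 * (ln 7 + ln (real N) + real d * ln (2 * real N))) / real N
      + 4 * ln m" for N :: nat
  have "(\<lambda>N. (ln (2 * real N + 1) + 2 * (ln 7 + ln (real N) + real d * ln (2 * real N))) / real N) \<longlonglongrightarrow> 0"
    by real_asymp
  then have lim: "F \<longlonglongrightarrow> 4 * ln m"
    unfolding F_def by (rule tendsto_eq_intros) auto
  have bound: "ln (real (card (products_upto G gens N))) / real N \<le> F N" if N: "N \<ge> 1" for N
  proof -
    define X where "X = real N * (2 * real N) ^ d * m ^ (2 * N)"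
    have "1 * 1 * 1 \<le> X"
      unfolding X_def using N m by (intro mult_mono one_le_power) auto
    then have X: "X \<ge> 1" by simp
    have "real (card (products_upto G gens N)) \<le> (2 * real N + 1) * (4 * X + 3)\<^sup>2"
      using card_products_upto_gens_le[OF irr monic root N] by (simp add: X_def m_def d_def)
    also have "\<dots> \<le> (2 * real N + 1) * (7 * X)\<^sup>2"
      using X by (intro mult_left_mono power_mono) auto
    finally have "ln (real (card (products_upto G gens N))) \<le> ln ((2 * real N + 1) * (7 * X)\<^sup>2)"
      using G.card_products_upto_pos[OF gens(1), of N] by (intro ln_mono) auto
    also have "\<dots> = ln (2 * real N + 1) + 2 * (ln 7 + ln X)"
    proof -
      have "ln ((2 * real N + 1) * (7 * X)\<^sup>2) = ln (2 * real N + 1) + ln ((7 * X)\<^sup>2)"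
        using X by (intro ln_mult_pos) auto
      also have "ln ((7 * X)\<^sup>2) = 2 * ln (7 * X)" using X by (subst ln_realpow) auto
      also have "ln (7 * X) = ln 7 + ln X" using X by (intro ln_mult_pos) auto
      finally show ?thesis .
    qed
    also have "ln X = ln (real N) + real d * ln (2 * real N) + real (2 * N) * ln m"
      unfolding X_def using N m by (simp add: ln_mult ln_realpow algebra_simps)
    finally have "ln (real (card (products_upto G gens N))) \<le>
        ln (2 * real N + 1) + 2 * (ln 7 + ln (real N) + real d * ln (2 * real N)) + 4 * ln m * real N"
      by (simp add: algebra_simps)
    then have "ln (real (card (products_upto G gens N))) / real N \<le>
        (ln (2 * real N + 1) + 2 * (ln 7 + ln (real N) + real d * ln (2 * real N)) + 4 * ln m * real N) / real N"
      by (rule divide_right_mono) simp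
    also have "\<dots> = F N" using N by (simp add: F_def add_divide_distrib)
    finally show ?thesis .
  qed
  have "entropy_wrt G gens \<le> 4 * ln m"
    using G.entropy_wrt_limit[OF gens] lim bound by (intro LIMSEQ_le) auto
  then show ?thesis
    using G.algebraic_entropy_le[OF gens_sym] by (simp add: m_def)
qed

theorem mainTheorem6:
  assumes "\<exists>\<epsilon>\<^sub>0 > 0. \<forall>\<Gamma> :: nat monoid.
             finitely_generated_group \<Gamma> \<and> metabelian_group \<Gamma> \<and> \<not> virtually_nilpotent_group \<Gamma>
             \<longrightarrow> algebraic_entropy \<Gamma> \<ge> \<epsilon>\<^sub>0"
  shows "\<exists>\<epsilon>\<^sub>1 > (0 :: real). \<forall>\<pi> :: int poly.
           lead_coeff \<pi> = 1 \<longrightarrow> mahler_measure \<pi> > 1 \<longrightarrow> mahler_measure \<pi> > 1 + \<epsilon>\<^sub>1"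
proof -
  obtain \<epsilon>\<^sub>0 :: real where e0: "\<epsilon>\<^sub>0 > 0" and entropy: "\<And>\<Gamma> :: nat monoid.
      finitely_generated_group \<Gamma> \<Longrightarrow> metabelian_group \<Gamma> \<Longrightarrow> \<not> virtually_nilpotent_group \<Gamma> \<Longrightarrow>
      algebraic_entropy \<Gamma> \<ge> \<epsilon>\<^sub>0"
    using assms by blast
  have "mahler_measure \<pi> > 1 + \<epsilon>\<^sub>0 / 8" if monic: "lead_coeff \<pi> = 1" and gt: "mahler_measure \<pi> > 1"
    for \<pi> :: "int poly"
  proof -
    obtain p \<theta> where p: "irreducible\<^sub>d p" "lead_coeff p = 1" "poly (cpoly p) \<theta> = 0"
      and \<theta>: "cmod \<theta> > 1" and le: "mahler_measure p \<le> mahler_measure \<pi>"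
      using irreducible_monic_factor[OF monic gt] by blast
    obtain K :: "nat monoid" and \<psi> t u where "affine_embedding K \<psi> \<theta> t u"
      using affine_embedding_exists[OF \<theta>] by blast
    then interpret affine_embedding K \<psi> \<theta> t u .
    \<comment> \<open>This gives \<open>m(p) \<ge> exp (\<epsilon>\<^sub>0 / 4) \<ge> 1 + \<epsilon>\<^sub>0 / 4\<close>; halving \<open>\<epsilon>\<^sub>0 / 4\<close> makes the final inequality strict.\<close>
    have "\<epsilon>\<^sub>0 \<le> 4 * ln (mahler_measure p)"
      using entropy[OF finitely_generated metabelian not_virtually_nilpotent]
        entropy_le_mahler[OF p] by (rule order.trans)
    then have "exp (\<epsilon>\<^sub>0 / 4) \<le> exp (ln (mahler_measure p))" by simp
    also have "\<dots> = mahler_measure p" using mahler_measure_monic_ge_1[OF p(2)] by simp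
    finally show ?thesis using exp_ge_add_one_self[of "\<epsilon>\<^sub>0 / 4"] e0 le by linarith
  qed
  then show ?thesis using e0 by (intro exI[of _ "\<epsilon>\<^sub>0 / 8"]) auto
qed

end
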